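(* Let $\mathcal{H}$ be a finite hypergraph, let $X=e(\mathcal{H}_p)$ and $\mu=\mathbb{E}X$. For all $D\ge1$, $p\in(0,1]$ and $t\ge0$ satisfying $\mathfrak{X}(\mathcal{H},D,\mu+t)$ and $\mu+t\ge1$ we have \[ \Pr(X\ge\mu+t)\ge\exp\bigl(-D\sqrt{\mu+t}\,\log(1/p)\bigr). \]
   Context: $V_p(\mathcal{H})$ is the random subset of $V(\mathcal{H})$ containing each vertex independently with probability $p$, and $\mathcal{H}_p=\mathcal{H}[V_p(\mathcal{H})]$. The property $\mathfrak{X}(\mathcal{H},D,x)$ means: there exists $W\subseteq V(\mathcal{H})$ with $|W|\le D\max\{\sqrt{x},1\}$ and $e(\mathcal{H}[W])\ge x$. *)

theory Defs
  imports "HOL-Probability.Probability"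
begin

record 'a hypergraph =
  verts :: "'a set"
  edges :: "'a set set"

text \<open>Edges are arbitrary vertex subsets: no uniformity is assumed, and the empty edge is allowed.\<close>

definition finite_hypergraph :: "'a hypergraph \<Rightarrow> bool" where
  "finite_hypergraph H \<longleftrightarrow> finite (verts H) \<and> edges H \<subseteq> Pow (verts H)"

definition num_edges :: "'a hypergraph \<Rightarrow> nat" where
  "num_edges H = card (edges H)"

text \<open>The induced subhypergraph \<open>H[W]\<close>, meant for \<open>W \<subseteq> verts H\<close>.\<close>

definition induced :: "'a hypergraph \<Rightarrow> 'a set \<Rightarrow> 'a hypergraph" where
  "induced H W = \<lparr>verts = W, edges = {e \<in> edges H. e \<subseteq> W}\<rparr>"

text \<open>
  The law of \<open>V\<^sub>p(H)\<close>: the successes among independent Bernoulli(\<open>p\<close>) trials, one for each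
  vertex. It is the intended one for finite \<open>verts H\<close> and \<open>0 \<le> p \<le> 1\<close>.
\<close>

definition random_verts :: "'a hypergraph \<Rightarrow> real \<Rightarrow> 'a set pmf" where
  "random_verts H p =
     map_pmf (\<lambda>f. {v \<in> verts H. f v}) (Pi_pmf (verts H) False (\<lambda>_. bernoulli_pmf p))"

text \<open>The law of \<open>H\<^sub>p = H[V\<^sub>p(H)]\<close>.\<close>

definition random_induced :: "'a hypergraph \<Rightarrow> real \<Rightarrow> 'a hypergraph pmf" where
  "random_induced H p = map_pmf (induced H) (random_verts H p)"

text \<open>The property \<open>\<XX>(H, D, x)\<close>.\<close>

definition property_X :: "'a hypergraph \<Rightarrow> real \<Rightarrow> real \<Rightarrow> bool" where
  "property_X H D x \<longleftrightarrow>
     (\<exists>W \<subseteq> verts H. real (card W) \<le> D * max (sqrt x) 1 \<and> real (num_edges (induced H W)) \<ge> x)"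

end

theory Submission
  imports Defs
begin

text \<open>Planting one dense set suffices. Let \<open>W\<close> be a witness of
  \<open>property_X\<close>. Whenever the random vertex set contains \<open>W\<close>, every edge of
  \<open>induced H W\<close> survives, so the edge count is at least \<open>\<mu> + t\<close>
  (\<open>num_edges_induced_mono\<close>). By independence this happens with probability
  \<open>p ^ card W\<close> (\<open>prob_subset_random_verts\<close>), and the bound on
  \<open>card W\<close> turns this power into the claimed exponential.\<close>

lemma num_edges_induced_mono:
  assumes "finite_hypergraph H" and "W \<subseteq> V"
  shows "num_edges (induced H W) \<le> num_edges (induced H V)"
proof -
  have "finite (edges H)"
    using assms(1) unfolding finite_hypergraph_def by (meson finite_Pow_iff finite_subset)
  then show ?thesis
    unfolding num_edges_def induced_def using assms(2) by (auto intro!: card_mono)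
qed

text \<open>The event is a box in the product space: coordinates in \<open>W\<close> are forced to
  be \<open>True\<close> and the others are free, so its probability factorises.\<close>

lemma prob_subset_random_verts:
  assumes "finite (verts H)" and "W \<subseteq> verts H" and "0 \<le> p" and "p \<le> 1"
  shows "measure_pmf.prob (random_verts H p) {V. W \<subseteq> V} = p ^ card W"
proof -
  define B where "B v = (if v \<in> W then {True} else UNIV)" for v
  \<comment> \<open>This needs \<open>W \<subseteq> verts H\<close>, since vertices outside
    \<open>verts H\<close> are never selected.\<close>
  have "(\<lambda>f. {v \<in> verts H. f v}) -` {V. W \<subseteq> V} = Pi (verts H) B"
    using assms(2) by (auto simp: B_def Pi_def)
  then have "measure_pmf.prob (random_verts H p) {V. W \<subseteq> V} =
      (\<Prod>v\<in>verts H. measure_pmf.prob (bernoulli_pmf p) (B v))"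
    by (simp add: random_verts_def measure_Pi_pmf_Pi assms(1))
  also have "\<dots> = (\<Prod>v\<in>verts H. if v \<in> W then p else 1)"
    using assms(3,4) by (intro prod.cong) (auto simp: B_def measure_pmf_single)
  also have "\<dots> = p ^ card W"
    using assms(1,2) by (simp add: prod.If_cases Int_absorb1)
  finally show ?thesis .
qed

theorem theorem4p1:
  fixes H :: "'a hypergraph" and D p t \<mu> :: real
  assumes "finite_hypergraph H"
    and "D \<ge> 1" and "0 < p" and "p \<le> 1" and "t \<ge> 0"
    and "\<mu> = measure_pmf.expectation (random_induced H p) (\<lambda>G. real (num_edges G))"
    and "property_X H D (\<mu> + t)"
    and "\<mu> + t \<ge> 1"
  shows "measure_pmf.prob (random_induced H p) {G. real (num_edges G) \<ge> \<mu> + t}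
           \<ge> exp (- D * sqrt (\<mu> + t) * ln (1 / p))"
proof -
  \<comment> \<open>As \<open>\<mu> + t \<ge> 1\<close>, the maximum in \<open>property_X\<close> is
    the square root.\<close>
  obtain W where W: "W \<subseteq> verts H" "real (card W) \<le> D * sqrt (\<mu> + t)"
      "\<mu> + t \<le> real (num_edges (induced H W))"
    using assms(7,8) unfolding property_X_def by auto
  have "exp (- D * sqrt (\<mu> + t) * ln (1 / p)) = exp (D * sqrt (\<mu> + t) * ln p)"
    using assms(3) by (simp add: ln_div)
  \<comment> \<open>Here \<open>ln p \<le> 0\<close>, so the upper bound on \<open>card W\<close>
    gives a lower bound on the probability.\<close>
  also have "\<dots> \<le> exp (real (card W) * ln p)"
    using W(2) assms(3,4) by (simp add: mult_right_mono_neg)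
  also have "\<dots> = p ^ card W"
    using assms(3) by (simp add: exp_of_nat_mult)
  also have "\<dots> = measure_pmf.prob (random_verts H p) {V. W \<subseteq> V}"
    using assms(1,3,4) W(1) by (simp add: prob_subset_random_verts finite_hypergraph_def)
  also have "\<dots> \<le> measure_pmf.prob (random_verts H p)
      (induced H -` {G. real (num_edges G) \<ge> \<mu> + t})"
    using W(3) num_edges_induced_mono[OF assms(1)]
    by (intro measure_pmf.finite_measure_mono) (auto intro: order_trans)
  also have "\<dots> = measure_pmf.prob (random_induced H p) {G. real (num_edges G) \<ge> \<mu> + t}"
    by (simp add: random_induced_def)
  finally show ?thesis .
qed

end
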